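(* Fix $t>0$, $\theta>0$, $\mu\in\mathbb{R}$ and $\sigma>0$. For $x_0\in\mathbb{R}$ let $\gamma_{x_0}$ be the Gaussian probability measure on $\mathbb{R}$ with mean $m_t=x_0e^{-\theta t}+\mu(1-e^{-\theta t})$ and variance $\sigma_t^2=\frac{\sigma^2}{2\theta}\left(1-e^{-2\theta t}\right)$. For $n\in\mathbb{N}$, $n\ge 1$, define $T_n:\mathbb{R}^n\to\mathbb{R}$ by $$T_n(z_1,\dots,z_n)=e^{\theta t}\,\frac{\sum_{k=1}^n z_k}{n}-\mu e^{\theta t}(1-e^{-\theta t}).$$ Then for every $x_0\in\mathbb{R}$, $$\gamma_{x_0}^{\infty}\left(\left\{(z_k)_{k\in\mathbb{N}}\in\mathbb{R}^{\infty}:\ \lim_{n\to\infty}T_n(z_1,\dots,z_n)=x_0\right\}\right)=1,$$ that is, $T_n$ is a consistent estimator of the parameter $x_0\in\mathbb{R}$, in the sense of convergence almost everywhere, for the family $(\gamma_{x_0}^{\infty})_{x_0\in\mathbb{R}}$.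
   Context: $\mathbb{R}^\infty=\mathbb{R}^{\mathbb{N}}$ is the space of real sequences $(z_k)_{k\in\mathbb{N}}$, $\mathbb{N}=\{1,2,\dots\}$, with its product Borel $\sigma$-algebra; for a Borel probability measure $\gamma$ on $\mathbb{R}$, $\gamma^{\infty}$ denotes the infinite product measure $\gamma\times\gamma\times\cdots$ on $\mathbb{R}^\infty$. Given a family $(\gamma_\vartheta)_{\vartheta\in\Theta}$ of Borel probability measures on $\mathbb{R}$ with $\Theta\subseteq\mathbb{R}$, a sequence of Borel measurable functions $T_n:\mathbb{R}^n\to\mathbb{R}$ is called a consistent estimator of the parameter $\vartheta$ in the sense of convergence almost everywhere for the family $(\gamma_\vartheta^\infty)_{\vartheta\in\Theta}$ if $\gamma_\vartheta^\infty(\{(z_k)_{k\in\mathbb{N}}:\lim_{n\to\infty}T_n(z_1,\dots,z_n)=\vartheta\})=1$ for each $\vartheta\in\Theta$. (The measure $\gamma_{x_0}$ is the law at time $t$ of the Ornstein-Uhlenbeck process $x_t=x_0e^{-\theta t}+\mu(1-e^{-\theta t})+\sigma\int_0^te^{-\theta(t-s)}dW_s$ with $W$ a Wiener process; the claim only uses $\gamma_{x_0}$ as defined in it.) *)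

theory Defs
  imports "HOL-Probability.Probability"
begin

text \<open>
  Sequences are indexed by \<open>{1..}\<close>, and points of the \<open>n\<close>-dimensional real space by \<open>{1..n}\<close>.
  Both are represented by extensional functions on \<^typ>\<open>nat\<close>, as in \<^const>\<open>PiM\<close>.
\<close>

definition infinite_product :: "real measure \<Rightarrow> (nat \<Rightarrow> real) measure" where
  "infinite_product \<gamma> = PiM {1..} (\<lambda>_. \<gamma>)"

text \<open>
  The value \<open>T 0\<close> is irrelevant. Since \<^const>\<open>measure\<close> is \<open>0\<close> outside the \<open>\<sigma>\<close>-algebra,
  the last conjunct also says that the convergence set is measurable.
\<close>

definition consistent_estimator_ae ::
    "real set \<Rightarrow> (real \<Rightarrow> real measure) \<Rightarrow> (nat \<Rightarrow> (nat \<Rightarrow> real) \<Rightarrow> real) \<Rightarrow> bool" where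
  "consistent_estimator_ae \<Theta> \<gamma> T \<longleftrightarrow>
     (\<forall>\<theta>\<in>\<Theta>. prob_space (\<gamma> \<theta>) \<and> sets (\<gamma> \<theta>) = sets borel) \<and>
     (\<forall>n\<ge>1. T n \<in> borel_measurable (PiM {1..n} (\<lambda>_. borel))) \<and>
     (\<forall>\<theta>\<in>\<Theta>. measure (infinite_product (\<gamma> \<theta>))
        {z \<in> space (infinite_product (\<gamma> \<theta>)).
           (\<lambda>n. T n (restrict z {1..n})) \<longlonglongrightarrow> \<theta>} = 1)"

text \<open>Parameters are mean and variance, whereas \<^const>\<open>normal_density\<close> takes the standard deviation.\<close>

definition gaussian :: "real \<Rightarrow> real \<Rightarrow> real measure" where
  "gaussian m v = density lborel (\<lambda>x. ennreal (normal_density m (sqrt v) x))"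

definition ou_mean :: "real \<Rightarrow> real \<Rightarrow> real \<Rightarrow> real \<Rightarrow> real" where
  "ou_mean t \<theta> \<mu> x\<^sub>0 = x\<^sub>0 * exp (- \<theta> * t) + \<mu> * (1 - exp (- \<theta> * t))"

definition ou_variance :: "real \<Rightarrow> real \<Rightarrow> real \<Rightarrow> real" where
  "ou_variance t \<theta> \<sigma> = \<sigma>\<^sup>2 / (2 * \<theta>) * (1 - exp (- 2 * \<theta> * t))"

definition ou_law :: "real \<Rightarrow> real \<Rightarrow> real \<Rightarrow> real \<Rightarrow> real \<Rightarrow> real measure" where
  "ou_law t \<theta> \<mu> \<sigma> x\<^sub>0 = gaussian (ou_mean t \<theta> \<mu> x\<^sub>0) (ou_variance t \<theta> \<sigma>)"

definition ou_estimator :: "real \<Rightarrow> real \<Rightarrow> real \<Rightarrow> nat \<Rightarrow> (nat \<Rightarrow> real) \<Rightarrow> real" where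
  "ou_estimator t \<theta> \<mu> n z =
     exp (\<theta> * t) * ((\<Sum>k=1..n. z k) / real n) - \<mu> * exp (\<theta> * t) * (1 - exp (- \<theta> * t))"

end

theory Submission
  imports Defs
begin

text \<open>
  The mean of \<open>n\<close> independent normal variables with mean \<open>\<mu>\<close> and standard deviation \<open>\<sigma>\<close> is again
  normal, so its fourth central moment is \<open>3 \<sigma>^4 / n^2\<close>. These moments are summable; hence almost
  surely the fourth powers of the deviations from \<open>\<mu>\<close> are summable and tend to \<open>0\<close>. The estimator
  is the affine function of the empirical mean that inverts \<open>x\<^sub>0 \<mapsto> m\<^sub>t\<close>.
\<close>

text \<open>The law of \<open>X\<close> turns this into a moment of the density, and the factor 3 is
  \<open>4! / (2^2 * 2!)\<close> from the formula for even normal moments. The nonnegative integral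
  is the form needed for summing over \<open>n\<close>.\<close>

lemma (in prob_space) nn_integral_normal_fourth_central_moment:
  assumes "distributed M lborel X (normal_density \<mu> \<sigma>)" and "\<sigma> > 0"
  shows "(\<integral>\<^sup>+ x. ennreal ((X x - \<mu>) ^ 4) \<partial>M) = ennreal (3 * \<sigma> ^ 4)"
proof -
  have moment: "has_bochner_integral lborel (\<lambda>x. normal_density \<mu> \<sigma> x * (x - \<mu>) ^ 4) (3 * \<sigma> ^ 4)"
    using normal_moment_even[OF \<open>\<sigma> > 0\<close>, of \<mu> 2] \<open>\<sigma> > 0\<close>
    by (simp add: fact_numeral field_simps)
  have "(\<integral>\<^sup>+ x. ennreal ((X x - \<mu>) ^ 4) \<partial>M) =
      (\<integral>\<^sup>+ x. ennreal (normal_density \<mu> \<sigma> x) * ennreal ((x - \<mu>) ^ 4) \<partial>lborel)"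
    by (rule distributed_nn_integral[OF assms(1), symmetric]) simp
  also have "\<dots> = (\<integral>\<^sup>+ x. ennreal (normal_density \<mu> \<sigma> x * (x - \<mu>) ^ 4) \<partial>lborel)"
    by (simp add: ennreal_mult')
  also have "\<dots> = ennreal (3 * \<sigma> ^ 4)"
    using moment by (subst nn_integral_eq_integral)
      (auto simp: has_bochner_integral_iff)
  finally show ?thesis .
qed

text \<open>Sum and integral commute for nonnegative functions, so the series has a finite integral
  and is finite almost everywhere. The terms of a convergent series tend to 0.\<close>

lemma AE_tendsto_zero_if_nn_integral_summable:
  fixes f :: "nat \<Rightarrow> 'a \<Rightarrow> real"
  assumes [measurable]: "\<And>n. f n \<in> borel_measurable M"
    and nonneg: "\<And>n x. f n x \<ge> 0"
    and finite: "(\<Sum>n. \<integral>\<^sup>+ x. ennreal (f n x) \<partial>M) \<noteq> \<infinity>"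
  shows "AE x in M. (\<lambda>n. f n x) \<longlonglongrightarrow> 0"
proof -
  have "AE x in M. (\<Sum>n. ennreal (f n x)) \<noteq> \<infinity>"
    using finite by (intro nn_integral_noteq_infinite) (simp_all add: nn_integral_suminf)
  then show ?thesis
  proof eventually_elim
    case (elim x)
    then have "summable (\<lambda>n. f n x)"
      using nonneg by (intro summable_suminf_not_top) auto
    then show ?case
      by (rule summable_LIMSEQ_zero)
  qed
qed

lemma (in prob_space) normal_mean_indep:
  assumes "finite I" and "I \<noteq> {}" and "indep_vars (\<lambda>_. borel) X I"
    and "\<And>i. i \<in> I \<Longrightarrow> distributed M lborel (X i) (normal_density \<mu> \<sigma>)" and "\<sigma> > 0"
  shows "distributed M lborel (\<lambda>x. (\<Sum>i\<in>I. X i x) / real (card I))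
    (normal_density \<mu> (\<sigma> / sqrt (real (card I))))"
proof -
  have card: "real (card I) > 0"
    using assms(1,2) by (simp add: card_gt_0_iff)
  have "distributed M lborel (\<lambda>x. \<Sum>i\<in>I. X i x)
      (normal_density (\<Sum>i\<in>I. \<mu>) (sqrt (\<Sum>i\<in>I. \<sigma>\<^sup>2)))"
    using assms by (intro sum_indep_normal) auto
  \<comment> \<open>The mean is the affine image of the sum with shift 0 and slope
    \<open>1 / card I\<close>, written out so that \<open>normal_density_affine\<close>
    matches.\<close>
  then have "distributed M lborel (\<lambda>x. 0 + 1 / real (card I) * (\<Sum>i\<in>I. X i x))
      (normal_density (0 + 1 / real (card I) * (\<Sum>i\<in>I. \<mu>))
        (\<bar>1 / real (card I)\<bar> * sqrt (\<Sum>i\<in>I. \<sigma>\<^sup>2)))"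
    using card \<open>\<sigma> > 0\<close> by (intro normal_density_affine) auto
  moreover have "\<bar>1 / real (card I)\<bar> * sqrt (\<Sum>i\<in>I. \<sigma>\<^sup>2) = \<sigma> / sqrt (real (card I))"
    using card \<open>\<sigma> > 0\<close> by (simp add: real_sqrt_mult real_div_sqrt field_simps)
  ultimately show ?thesis
    using card by simp
qed

lemma (in prob_space) strong_law_normal:
  fixes X :: "nat \<Rightarrow> 'a \<Rightarrow> real"
  assumes indep: "indep_vars (\<lambda>_. borel) X {1..}"
    and normal: "\<And>k. k \<ge> 1 \<Longrightarrow> distributed M lborel (X k) (normal_density \<mu> \<sigma>)"
    and "\<sigma> > 0"
  shows "AE x in M. (\<lambda>n. (\<Sum>k=1..n. X k x) / real n) \<longlonglongrightarrow> \<mu>"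
proof -
  \<comment> \<open>Squares would not do: the second moments \<open>\<sigma>\<^sup>2 / n\<close>
    have a divergent sum. Indexing by \<open>Suc n\<close> keeps the sample nonempty and the
    denominator nonzero.\<close>
  define D where "D n x = ((\<Sum>k=1..Suc n. X k x) / real (Suc n) - \<mu>) ^ 4" for n x
  have D_measurable: "D n \<in> borel_measurable M" for n
    unfolding D_def using indep
    by (intro borel_measurable_power borel_measurable_diff borel_measurable_divide
        borel_measurable_sum borel_measurable_const) (auto simp: indep_vars_def)
  have moment: "(\<integral>\<^sup>+ x. ennreal (D n x) \<partial>M) = ennreal (3 * \<sigma> ^ 4 * inverse ((real (Suc n))\<^sup>2))" for n
  proof -
    have "indep_vars (\<lambda>_. borel) X {1..Suc n}"
      using indep by (rule indep_vars_subset) auto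
    then have "distributed M lborel (\<lambda>x. (\<Sum>k=1..Suc n. X k x) / real (card {1..Suc n}))
        (normal_density \<mu> (\<sigma> / sqrt (real (card {1..Suc n}))))"
      using normal \<open>\<sigma> > 0\<close> by (intro normal_mean_indep) auto
    from nn_integral_normal_fourth_central_moment[OF this]
    have "(\<integral>\<^sup>+ x. ennreal (D n x) \<partial>M) = ennreal (3 * (\<sigma> / sqrt (real (Suc n))) ^ 4)"
      using \<open>\<sigma> > 0\<close> by (simp add: D_def)
    also have "(sqrt (real (Suc n))) ^ 4 = (real (Suc n))\<^sup>2"
      using power_mult[of "sqrt (real (Suc n))" 2 2] by simp
    then have "3 * (\<sigma> / sqrt (real (Suc n))) ^ 4 = 3 * \<sigma> ^ 4 * inverse ((real (Suc n))\<^sup>2)"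
      by (simp only: power_divide) (simp add: field_simps)
    finally show ?thesis .
  qed
  have "summable (\<lambda>n. 3 * \<sigma> ^ 4 * inverse ((real (Suc n))\<^sup>2))"
    by (intro summable_mult, subst summable_Suc_iff) (rule inverse_power_summable, simp)
  then have "(\<Sum>n. \<integral>\<^sup>+ x. ennreal (D n x) \<partial>M) \<noteq> \<infinity>"
    unfolding moment infinity_ennreal_def by (rule ennreal_suminf_neq_top) simp
  then have "AE x in M. (\<lambda>n. D n x) \<longlonglongrightarrow> 0"
    by (intro AE_tendsto_zero_if_nn_integral_summable D_measurable) (simp_all add: D_def)
  then show ?thesis
  proof eventually_elim
    case (elim x)
    then have "(\<lambda>n. (\<Sum>k=1..Suc n. X k x) / real (Suc n)) \<longlonglongrightarrow> \<mu>"
      unfolding D_def by (subst (asm) power_tendsto_0_iff) (auto simp: LIM_zero_iff)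
    then show ?case
      \<comment> \<open>The index shift in \<open>D\<close> is undone; it does not affect the
        limit.\<close>
      by (rule LIMSEQ_imp_Suc)
  qed
qed

text \<open>Independence means that the joint law is the product of the marginals. Points of
  \<open>PiM I M\<close> are extensional, so the joint map is the identity on the space, and the
  marginals are the factors \<open>M i\<close>: both laws equal \<open>PiM I M\<close>.\<close>

lemma indep_vars_PiM_component:
  assumes M: "\<And>i. i \<in> I \<Longrightarrow> prob_space (M i)" and "I \<noteq> {}"
  shows "prob_space.indep_vars (PiM I M) M (\<lambda>i \<omega>. \<omega> i) I"
proof -
  interpret prob_space "PiM I M"
    by (rule prob_space_PiM) (rule M)
  have "distr (PiM I M) (PiM I M) (\<lambda>\<omega>. \<lambda>i\<in>I. \<omega> i) = distr (PiM I M) (PiM I M) (\<lambda>\<omega>. \<omega>)"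
    by (rule distr_cong) (auto simp: space_PiM PiE_restrict)
  also have "\<dots> = PiM I (\<lambda>i. distr (PiM I M) (M i) (\<lambda>\<omega>. \<omega> i))"
    by (simp add: distr_PiM_component M cong: PiM_cong)
  finally show ?thesis
    using \<open>I \<noteq> {}\<close> by (subst indep_vars_iff_distr_eq_PiM') auto
qed

lemma sets_gaussian: "sets (gaussian m v) = sets borel"
  by (simp add: gaussian_def)

lemma prob_space_gaussian:
  assumes "v > 0"
  shows "prob_space (gaussian m v)"
  unfolding gaussian_def using assms by (intro prob_space_normal_density) simp

lemma prob_space_infinite_product:
  "prob_space \<gamma> \<Longrightarrow> prob_space (infinite_product \<gamma>)"
  unfolding infinite_product_def by (rule prob_space_PiM)

lemma measurable_infinite_product_component:
  assumes "sets \<gamma> = sets borel" and "k \<ge> 1"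
  shows "(\<lambda>z. z k) \<in> borel_measurable (infinite_product \<gamma>)"
proof -
  have "(\<lambda>z. z k) \<in> measurable (infinite_product \<gamma>) \<gamma>"
    unfolding infinite_product_def using assms(2) by (intro measurable_component_singleton) simp
  then show ?thesis
    by (simp cong: measurable_cong_sets add: measurable_cong_sets[OF refl assms(1)])
qed

text \<open>Under the product measure the coordinates are an independent sample from
  \<open>gaussian m v\<close>, so the strong law applies with standard deviation
  \<open>sqrt v\<close>.\<close>

lemma AE_infinite_product_gaussian_mean:
  assumes "v > 0"
  shows "AE z in infinite_product (gaussian m v). (\<lambda>n. (\<Sum>k=1..n. z k) / real n) \<longlonglongrightarrow> m"
proof -
  interpret prob_space "infinite_product (gaussian m v)"
    by (intro prob_space_infinite_product prob_space_gaussian assms)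
  have "indep_vars (\<lambda>_. gaussian m v) (\<lambda>k z. z k) {1..}"
    unfolding infinite_product_def
    by (rule indep_vars_PiM_component) (auto intro: prob_space_gaussian assms)
  then have indep: "indep_vars (\<lambda>_. borel) (\<lambda>k z. z k) {1..}"
    by (rule indep_vars_compose2) (simp add: measurable_cong_sets[OF sets_gaussian refl])
  have "distributed (infinite_product (gaussian m v)) lborel (\<lambda>z. z k) (normal_density m (sqrt v))"
    if "k \<ge> 1" for k
  proof -
    \<comment> \<open>A push-forward depends on its target only through the sigma-algebra, so
      \<open>lborel\<close> may be replaced by the factor itself, whose marginal is known.\<close>
    have "distr (infinite_product (gaussian m v)) lborel (\<lambda>z. z k) =
        distr (infinite_product (gaussian m v)) (gaussian m v) (\<lambda>z. z k)"
      by (rule distr_cong) (simp_all add: sets_gaussian)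
    also have "\<dots> = gaussian m v"
      unfolding infinite_product_def using that
      by (intro distr_PiM_component) (auto intro: prob_space_gaussian assms)
    finally show ?thesis
      using measurable_infinite_product_component[OF sets_gaussian that]
      by (simp add: distributed_def gaussian_def)
  qed
  with indep show ?thesis
    using assms by (intro strong_law_normal[where \<sigma> = "sqrt v"]) auto
qed

lemma ou_variance_pos:
  assumes "t > 0" and "\<theta> > 0" and "\<sigma> > 0"
  shows "ou_variance t \<theta> \<sigma> > 0"
  using assms by (simp add: ou_variance_def)

text \<open>Only coordinates in \<open>{1..n}\<close> enter the sum, so the restriction disappears.
  The factored form is the inverse of the affine map \<open>ou_mean t \<theta> \<mu>\<close>,
  applied to the empirical mean.\<close>

lemma ou_estimator_eq:
  "ou_estimator t \<theta> \<mu> n (restrict z {1..n}) =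
    exp (\<theta> * t) * ((\<Sum>k=1..n. z k) / real n - \<mu> * (1 - exp (- \<theta> * t)))"
  by (simp add: ou_estimator_def algebra_simps)

lemma ou_mean_inverse: "exp (\<theta> * t) * (ou_mean t \<theta> \<mu> x - \<mu> * (1 - exp (- \<theta> * t))) = x"
  by (simp add: ou_mean_def flip: exp_add)

lemma measure_ou_estimator_tendsto:
  assumes "t > 0" and "\<theta> > 0" and "\<sigma> > 0"
  shows "measure (infinite_product (ou_law t \<theta> \<mu> \<sigma> x))
    {z \<in> space (infinite_product (ou_law t \<theta> \<mu> \<sigma> x)).
      (\<lambda>n. ou_estimator t \<theta> \<mu> n (restrict z {1..n})) \<longlonglongrightarrow> x} = 1"
proof -
  let ?P = "infinite_product (ou_law t \<theta> \<mu> \<sigma> x)"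
  have pos: "ou_variance t \<theta> \<sigma> > 0"
    using assms by (rule ou_variance_pos)
  interpret prob_space ?P
    unfolding ou_law_def by (intro prob_space_infinite_product prob_space_gaussian pos)
  \<comment> \<open>This makes the convergence set an event, which is required for passing from
    almost sure convergence to measure 1.\<close>
  have [measurable]: "(\<lambda>z. ou_estimator t \<theta> \<mu> n (restrict z {1..n})) \<in> borel_measurable ?P" for n
    unfolding ou_estimator_eq
    by (intro borel_measurable_times borel_measurable_diff borel_measurable_divide
        borel_measurable_sum borel_measurable_const measurable_infinite_product_component)
      (auto simp: ou_law_def sets_gaussian)
  have "AE z in ?P. (\<lambda>n. (\<Sum>k=1..n. z k) / real n) \<longlonglongrightarrow> ou_mean t \<theta> \<mu> x"
    unfolding ou_law_def by (rule AE_infinite_product_gaussian_mean[OF pos])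
  then have "AE z in ?P. (\<lambda>n. ou_estimator t \<theta> \<mu> n (restrict z {1..n})) \<longlonglongrightarrow> x"
  proof eventually_elim
    case (elim z)
    then have "(\<lambda>n. ou_estimator t \<theta> \<mu> n (restrict z {1..n})) \<longlonglongrightarrow>
        exp (\<theta> * t) * (ou_mean t \<theta> \<mu> x - \<mu> * (1 - exp (- \<theta> * t)))"
      unfolding ou_estimator_eq by (intro tendsto_intros)
    then show ?case
      by (simp only: ou_mean_inverse)
  qed
  then show ?thesis
    by (subst prob_Collect_eq_1) measurable
qed

theorem lemma3p1p1:
  fixes t \<theta> \<mu> \<sigma> :: real
  assumes "t > 0" and "\<theta> > 0" and "\<sigma> > 0"
  shows "(\<forall>x\<^sub>0::real. measure (infinite_product (ou_law t \<theta> \<mu> \<sigma> x\<^sub>0))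
           {z \<in> space (infinite_product (ou_law t \<theta> \<mu> \<sigma> x\<^sub>0)).
              (\<lambda>n. ou_estimator t \<theta> \<mu> n (restrict z {1..n})) \<longlonglongrightarrow> x\<^sub>0} = 1) \<and>
         consistent_estimator_ae UNIV (ou_law t \<theta> \<mu> \<sigma>) (ou_estimator t \<theta> \<mu>)"
proof -
  have "prob_space (ou_law t \<theta> \<mu> \<sigma> x)" and "sets (ou_law t \<theta> \<mu> \<sigma> x) = sets borel" for x
    unfolding ou_law_def by (simp_all add: prob_space_gaussian sets_gaussian ou_variance_pos assms)
  \<comment> \<open>Consistency also asks for measurability on the finite-dimensional space, where
    the estimator is a polynomial in the coordinates.\<close>
  moreover have "ou_estimator t \<theta> \<mu> n \<in> borel_measurable (PiM {1..n} (\<lambda>_. borel))" for n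
    unfolding ou_estimator_def by measurable
  ultimately show ?thesis
    unfolding consistent_estimator_ae_def using measure_ou_estimator_tendsto[OF assms] by blast
qed

end
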